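(* Let $F_2$ be a free group of rank two. Then the primitive width of $F_2$ is infinite, i.e. for every natural number $k$ there is an element of $F_2$ that is not a product of at most $k$ primitive elements of $F_2$.
   Context: Width: if $G$ is a group generated by a subset $S$, then for $g\in G$ the length $l_S(g)$ is the minimal $k$ such that $g$ is a product of $k$ elements of $S$; the width $\mathrm{wid}(G,S)$ is the supremum of $l_S(g)$ over $g\in G$ (a natural number or $\infty$). An element of a free group $F$ is primitive if it belongs to some basis (free generating set) of $F$. The primitive width of $F$ is the width of $F$ with respect to the set of all primitive elements of $F$. *)

theory Defs
  imports "HOL-Algebra.Generated_Groups" "HOL-Library.Extended_Nat"
begin

definition list_product :: "('a, 'b) monoid_scheme \<Rightarrow> 'a list \<Rightarrow> 'a" where
  "list_product G xs = foldr (\<otimes>\<^bsub>G\<^esub>) xs \<one>\<^bsub>G\<^esub>"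

(* The products of exactly k elements of S; inverses of elements of S are not
   allowed as factors unless they belong to S. The empty product is the identity. *)
definition products_of :: "('a, 'b) monoid_scheme \<Rightarrow> 'a set \<Rightarrow> nat \<Rightarrow> 'a set" where
  "products_of G S k = {list_product G xs | xs. set xs \<subseteq> S \<and> length xs = k}"

(* The infimum of a nonempty set of extended naturals is its minimum; it is \<infinity> for an
   element that is not a product of elements of S. *)
definition length_wrt :: "('a, 'b) monoid_scheme \<Rightarrow> 'a set \<Rightarrow> 'a \<Rightarrow> enat" where
  "length_wrt G S g = Inf {enat k | k. g \<in> products_of G S k}"

definition width :: "('a, 'b) monoid_scheme \<Rightarrow> 'a set \<Rightarrow> enat" where
  "width G S = (SUP g\<in>carrier G. length_wrt G S g)"

(* A word is a list of letters (x, e), where (x, True) stands for x and (x, False)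
   for the inverse of x. *)
definition letter_value :: "('a, 'b) monoid_scheme \<Rightarrow> 'a \<times> bool \<Rightarrow> 'a" where
  "letter_value G l = (if snd l then fst l else inv\<^bsub>G\<^esub> fst l)"

definition word_value :: "('a, 'b) monoid_scheme \<Rightarrow> ('a \<times> bool) list \<Rightarrow> 'a" where
  "word_value G w = list_product G (map (letter_value G) w)"

definition reduced_word :: "('a \<times> bool) list \<Rightarrow> bool" where
  "reduced_word w \<longleftrightarrow> successively (\<lambda>l m. \<not> (fst l = fst m \<and> snd l \<noteq> snd m)) w"

definition free_basis :: "('a, 'b) monoid_scheme \<Rightarrow> 'a set \<Rightarrow> bool" where
  "free_basis G S \<longleftrightarrow>
     S \<subseteq> carrier G \<and> generate G S = carrier G \<and>
     (\<forall>w. reduced_word w \<and> fst ` set w \<subseteq> S \<and> w \<noteq> [] \<longrightarrow> word_value G w \<noteq> \<one>\<^bsub>G\<^esub>)"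

definition free_group_of_rank :: "('a, 'b) monoid_scheme \<Rightarrow> nat \<Rightarrow> bool" where
  "free_group_of_rank G n \<longleftrightarrow>
     group G \<and> (\<exists>S. free_basis G S \<and> finite S \<and> card S = n)"

definition primitive_elements :: "('a, 'b) monoid_scheme \<Rightarrow> 'a set" where
  "primitive_elements G = {g. \<exists>S. free_basis G S \<and> g \<in> S}"

definition primitive_width :: "('a, 'b) monoid_scheme \<Rightarrow> enat" where
  "primitive_width G = width G (primitive_elements G)"

(* The primitive elements are closed under inverses and generate, so the width is not
   infinite merely because some element has no length. *)
lemma free_basis_m_inv:
  fixes G (structure)
  assumes "group G" "free_basis G S"
  shows "free_basis G ((\<lambda>x. inv\<^bsub>G\<^esub> x) ` S)"
proof -
  interpret group G by fact
  let ?I = "(\<lambda>x. inv\<^bsub>G\<^esub> x) ` S"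
  have S: "S \<subseteq> carrier G" "generate G S = carrier G"
    and R: "\<And>w. reduced_word w \<Longrightarrow> fst ` set w \<subseteq> S \<Longrightarrow> w \<noteq> [] \<Longrightarrow> word_value G w \<noteq> \<one>\<^bsub>G\<^esub>"
    using assms(2) unfolding free_basis_def by auto
  have I: "?I \<subseteq> carrier G" using S(1) by auto
  have "S \<subseteq> generate G ?I"
  proof
    fix x assume x: "x \<in> S"
    then have "inv (inv x) \<in> generate G ?I" by (intro generate.inv) auto
    then show "x \<in> generate G ?I" using x S(1) by auto
  qed
  then have "generate G S \<subseteq> generate G ?I"
    by (rule generate_subgroup_incl) (rule generate_is_subgroup[OF I])
  then have gen: "generate G ?I = carrier G" using S(2) generate_incl[OF I] by auto
  have "word_value G w \<noteq> \<one>" if w: "reduced_word w" "fst ` set w \<subseteq> ?I" "w \<noteq> []" for w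
  proof -
    let ?f = "\<lambda>l. (inv (fst l), \<not> snd l)"
    have wc: "fst l \<in> carrier G" if "l \<in> set w" for l
      using w(2) I that by fastforce
    have "reduced_word (map ?f w)"
      using w(1) unfolding reduced_word_def successively_map
      by (rule successively_mono) (use wc in \<open>auto dest: inj_onD[OF inv_inj]\<close>)
    moreover have "fst ` set (map ?f w) \<subseteq> S"
    proof -
      have "inv (fst l) \<in> S" if l: "l \<in> set w" for l
      proof -
        obtain x where "x \<in> S" "fst l = inv x" using w(2) l by blast
        then show ?thesis using S(1) by auto
      qed
      then show ?thesis by auto
    qed
    moreover have "word_value G (map ?f w) = word_value G w"
    proof -
      have "map (letter_value G \<circ> ?f) w = map (letter_value G) w"
        using wc by (auto simp: letter_value_def)
      then show ?thesis unfolding word_value_def map_map by (rule arg_cong)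
    qed
    ultimately show ?thesis using R w(3) by fastforce
  qed
  then show ?thesis unfolding free_basis_def using I gen by blast
qed

lemma length_wrt_primitive_finite:
  fixes G (structure)
  assumes "group G" "free_basis G S" "g \<in> carrier G"
  shows "length_wrt G (primitive_elements G) g < \<infinity>"
proof -
  interpret group G by fact
  let ?P = "primitive_elements G"
  have P: "?P \<subseteq> carrier G" unfolding primitive_elements_def free_basis_def by auto
  have single: "x \<in> products_of G ?P 1" if "x \<in> ?P" for x
    unfolding products_of_def list_product_def
    using that P by (auto intro!: exI[of _ "[x]"])
  have closed: "list_product G xs \<in> carrier G" if "set xs \<subseteq> ?P" for xs
    using that P unfolding list_product_def by (induction xs) auto
  have app: "list_product G (xs @ ys) = list_product G xs \<otimes> list_product G ys"
    if "set xs \<subseteq> ?P" "set ys \<subseteq> ?P" for xs ys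
    using that
  proof (induction xs)
    case Nil
    then show ?case using closed[of ys] by (simp add: list_product_def)
  next
    case (Cons x xs)
    then show ?case using closed[of xs] closed[of ys] P
      by (auto simp: list_product_def m_assoc)
  qed
  have "g \<in> generate G S" using assms(2,3) by (simp add: free_basis_def)
  then have "\<exists>k. g \<in> products_of G ?P k"
  proof (induction rule: generate.induct)
    case one
    show ?case unfolding products_of_def list_product_def by (auto intro!: exI[of _ "[]"])
  next
    case (incl h)
    then have "h \<in> ?P" using assms(2) unfolding primitive_elements_def by auto
    then show ?case using single by blast
  next
    case (inv h)
    then have "inv h \<in> ?P"
      using free_basis_m_inv[OF assms(1,2)] unfolding primitive_elements_def by auto
    then show ?case using single by blast
  next
    case (eng a b)
    then obtain xs ys where "set xs \<subseteq> ?P" "set ys \<subseteq> ?P"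
      "a = list_product G xs" "b = list_product G ys"
      unfolding products_of_def by auto
    then have "a \<otimes> b \<in> products_of G ?P (length (xs @ ys))"
      unfolding products_of_def using app[of xs ys]
      by (auto intro!: exI[of _ "xs @ ys"])
    then show ?case by blast
  qed
  then obtain k where "g \<in> products_of G ?P k" by blast
  then have "length_wrt G ?P g \<le> enat k"
    unfolding length_wrt_def by (intro Inf_lower) auto
  then show ?thesis by (rule order_le_less_trans) simp
qed

end

theory Submission
  imports Defs
begin

text \<open>Let \<open>\<theta>\<close> be the automorphism of the free group on \<open>x, y\<close> that inverts \<open>x\<close> and \<open>y\<close>. Nielsen moves and
  simultaneous conjugation preserve the property of a pair \<open>(a, b)\<close> that some \<open>c\<close> satisfies
  \<open>\<theta> a = c a\<^sup>-\<^sup>1 c\<^sup>-\<^sup>1\<close> and \<open>\<theta> b = c b\<^sup>-\<^sup>1 c\<^sup>-\<^sup>1\<close>, and they shorten every generating pair until it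
  consists of \<open>x\<^sup>\<plusminus>\<^sup>1\<close> and \<open>y\<^sup>\<plusminus>\<^sup>1\<close>, so every primitive \<open>p\<close> has \<open>\<theta> p\<close> conjugate to \<open>p\<^sup>-\<^sup>1\<close>. Summing the
  determinants of the vectors \<open>\<plusminus> e\<^sub>1, \<plusminus> e\<^sub>2\<close> of adjacent letters of the reduced word gives a
  quasimorphism \<open>f\<close> of defect 3 with \<open>f (g\<^sup>-\<^sup>1) = - f g\<close> and \<open>f (\<theta> g) = f g\<close>. Hence \<open>\<bar>f p\<bar> \<le> 3\<close> for
  primitive \<open>p\<close>, so \<open>f\<close> is at most \<open>6 k\<close> on products of \<open>k\<close> primitive elements, while it is
  unbounded on the powers of the commutator of \<open>x\<close> and \<open>y\<close>.\<close>

section \<open>Reduced words\<close>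

definition flip :: "'a \<times> bool \<Rightarrow> 'a \<times> bool" where
  "flip l = (fst l, \<not> snd l)"

definition inv_word :: "('a \<times> bool) list \<Rightarrow> ('a \<times> bool) list" where
  "inv_word w = rev (map flip w)"

lemma flip_flip [simp]: "flip (flip l) = l"
  by (simp add: flip_def)

lemma fst_flip [simp]: "fst (flip l) = fst l"
  by (simp add: flip_def)

lemma snd_flip [simp]: "snd (flip l) \<longleftrightarrow> \<not> snd l"
  by (simp add: flip_def)

lemma flip_neq [simp]: "flip l \<noteq> l" "l \<noteq> flip l"
  by (auto simp: flip_def prod_eq_iff)

lemma flip_eq_iff: "flip l = m \<longleftrightarrow> l = flip m"
  by auto

lemma inv_word_simps [simp]:
  "inv_word [] = []"
  "inv_word (l # w) = inv_word w @ [flip l]"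
  "inv_word (u @ v) = inv_word v @ inv_word u"
  "inv_word (inv_word w) = w"
  "length (inv_word w) = length w"
  "fst ` set (inv_word w) = fst ` set w"
  "inv_word w = [] \<longleftrightarrow> w = []"
  by (auto simp: inv_word_def rev_map image_image comp_def)

lemma map_flip_inv_word: "map flip (inv_word w) = inv_word (map flip w)"
  by (simp add: inv_word_def rev_map)

lemma inv_word_inject [simp]: "inv_word u = inv_word v \<longleftrightarrow> u = v"
  by (metis inv_word_simps(4))

lemma reduced_word_alt: "reduced_word w \<longleftrightarrow> successively (\<lambda>l m. m \<noteq> flip l) w"
proof -
  have "(\<lambda>l m. \<not> (fst l = fst m \<and> snd l \<noteq> snd m)) = (\<lambda>l m :: 'a \<times> bool. m \<noteq> flip l)"
    by (auto simp: fun_eq_iff flip_def)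
  then show ?thesis by (simp only: reduced_word_def)
qed

lemma reduced_word_Nil [simp]: "reduced_word []"
  by (simp add: reduced_word_def)

lemma reduced_word_single [simp]: "reduced_word [l]"
  by (simp add: reduced_word_def)

lemma reduced_word_append:
  "reduced_word (u @ v) \<longleftrightarrow>
     reduced_word u \<and> reduced_word v \<and> (u = [] \<or> v = [] \<or> hd v \<noteq> flip (last u))"
  by (auto simp: reduced_word_alt successively_append_iff)

lemma reduced_word_Cons:
  "reduced_word (l # v) \<longleftrightarrow> reduced_word v \<and> (v = [] \<or> hd v \<noteq> flip l)"
  using reduced_word_append[of "[l]" v] by simp

lemma reduced_inv_word [simp]: "reduced_word (inv_word w) \<longleftrightarrow> reduced_word w"
proof -
  have "reduced_word (inv_word w)" if "reduced_word w" for w :: "('a \<times> bool) list"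
    using that
  proof (induction w)
    case (Cons l w)
    then show ?case
      by (cases w) (auto simp: reduced_word_append reduced_word_Cons)
  qed simp
  from this[of w] this[of "inv_word w"] show ?thesis by auto
qed

lemma reduced_map_flip [simp]: "reduced_word (map flip w) \<longleftrightarrow> reduced_word w"
  by (auto simp: reduced_word_alt successively_map flip_eq_iff)

text \<open>Cancellation happens only at the seam: the last letter of \<open>u\<close> is stripped
  as long as it meets its inverse at the head of \<open>v\<close>, and the stripped letters form
  \<open>s\<close>. All later length counts rest on this decomposition.\<close>

lemma reduced_word_cancel:
  assumes "reduced_word u" "reduced_word v"
  obtains p s q where "u = p @ s" "v = inv_word s @ q" "reduced_word (p @ q)"
proof -
  have "\<exists>p s q. u = p @ s \<and> v = inv_word s @ q \<and> reduced_word (p @ q)"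
    using assms
  proof (induction u arbitrary: v rule: rev_induct)
    case Nil
    then show ?case by (intro exI[of _ "[]"] exI[of _ v]) simp
  next
    case (snoc l u)
    show ?case
    proof (cases "v \<noteq> [] \<and> hd v = flip l")
      case True
      then obtain v' where v: "v = flip l # v'" by (cases v) auto
      with snoc.prems have "reduced_word u" "reduced_word v'"
        by (auto simp: reduced_word_append reduced_word_Cons)
      from snoc.IH[OF this] obtain p s q
        where "u = p @ s" "v' = inv_word s @ q" "reduced_word (p @ q)" by blast
      then show ?thesis using v
        by (intro exI[of _ p] exI[of _ "s @ [l]"] exI[of _ q]) simp
    next
      case False
      with snoc.prems show ?thesis
        by (intro exI[of _ "u @ [l]"] exI[of _ "[]"] exI[of _ v])
          (auto simp: reduced_word_append reduced_word_Cons)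
    qed
  qed
  then show thesis using that by blast
qed

lemma reduced_append_inv_word:
  assumes "reduced_word (u @ inv_word u)"
  shows "u = []"
proof (cases u rule: rev_cases)
  case (snoc w l)
  then show ?thesis using assms by (simp add: reduced_word_append reduced_word_Cons)
qed

text \<open>The middle of \<open>d\<close> decides: for odd length the middle letter would be its
  own inverse, for even length the two middle letters would be adjacent and mutually
  inverse.\<close>

lemma reduced_self_inverse:
  assumes "reduced_word d" "inv_word d = d"
  shows "d = []"
proof (rule ccontr)
  assume "d \<noteq> []"
  define n where "n = length d"
  define i where "i = n div 2"
  have n: "n > 0" using \<open>d \<noteq> []\<close> by (simp add: n_def)
  have i: "i < n" using n by (simp add: i_def)
  have "d ! i = inv_word d ! i" using assms(2) by simp
  also have "\<dots> = flip (d ! (n - Suc i))"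
    using i by (simp add: inv_word_def rev_nth n_def)
  finally have eq: "d ! i = flip (d ! (n - Suc i))" .
  show False
  proof (cases "even n")
    case True
    then have "n - Suc i = i - 1" "i > 0" using n by (auto simp: i_def)
    moreover have "d ! Suc (i - 1) \<noteq> flip (d ! (i - 1))"
      using assms(1) i \<open>i > 0\<close> unfolding reduced_word_alt successively_conv_nth n_def
      by (metis Suc_pred' less_imp_diff_less)
    ultimately show False using eq by (metis Suc_pred' diff_Suc_1)
  next
    case False
    then have "n - Suc i = i" by (auto simp: i_def elim: oddE)
    then show False using eq by (metis flip_neq(2))
  qed
qed

text \<open>If \<open>s\<close> were at least half of \<open>w\<close>, then
  \<open>inv_word s = p @ d\<close> and \<open>s = d @ q\<close>, which forces
  \<open>d = inv_word d\<close>. So \<open>d\<close> is empty and \<open>w = p @ inv_word p\<close>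
  is not reduced. The bound limits the cancellation in a square.\<close>

lemma reduced_self_cancel:
  assumes "reduced_word w" "w = p @ s" "w = inv_word s @ q" "w \<noteq> []"
  shows "2 * length s < length w"
proof (rule ccontr)
  assume "\<not> ?thesis"
  then have "length p \<le> length s" using assms(2) by simp
  moreover have "p @ s = inv_word s @ q" using assms by simp
  ultimately have ps: "p = take (length p) (inv_word s)" "s = drop (length p) (inv_word s) @ q"
    by (simp_all add: append_eq_append_conv_if)
  define d where "d = drop (length p) (inv_word s)"
  have d: "inv_word s = p @ d" "s = d @ q"
    using ps append_take_drop_id[of "length p" "inv_word s"] by (simp_all add: d_def)
  have "s = inv_word d @ inv_word p"
    using arg_cong[OF d(1), of inv_word] by simp
  then have e: "d @ q = inv_word d @ inv_word p" using d(2) by simp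
  then have "d = inv_word d" "q = inv_word p"
    by (auto simp: append_eq_append_conv)
  moreover have "reduced_word d"
    using assms(1,2) d(2) by (simp add: reduced_word_append)
  ultimately have "d = []" by (metis reduced_self_inverse)
  then have "w = p @ inv_word p" using assms(2) d(2) \<open>q = inv_word p\<close> by simp
  then show False using assms(1,4) reduced_append_inv_word by fastforce
qed

section \<open>Normal forms\<close>

context group
begin

abbreviation lval :: "'a \<times> bool \<Rightarrow> 'a" where
  "lval \<equiv> letter_value G"

abbreviation wval :: "('a \<times> bool) list \<Rightarrow> 'a" where
  "wval \<equiv> word_value G"

lemma cancel_left [simp]:
  "a \<in> carrier G \<Longrightarrow> b \<in> carrier G \<Longrightarrow> inv a \<otimes> (a \<otimes> b) = b"
  "a \<in> carrier G \<Longrightarrow> b \<in> carrier G \<Longrightarrow> a \<otimes> (inv a \<otimes> b) = b"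
  by (simp_all add: m_assoc[symmetric])

lemma lval_closed [simp]: "fst l \<in> carrier G \<Longrightarrow> lval l \<in> carrier G"
  by (simp add: letter_value_def)

lemma lval_flip [simp]: "fst l \<in> carrier G \<Longrightarrow> lval (flip l) = inv (lval l)"
  by (simp add: letter_value_def)

lemma wval_Nil [simp]: "wval [] = \<one>"
  by (simp add: word_value_def list_product_def)

lemma wval_Cons [simp]: "wval (l # w) = lval l \<otimes> wval w"
  by (simp add: word_value_def list_product_def)

lemma wval_closed [simp]: "fst ` set w \<subseteq> carrier G \<Longrightarrow> wval w \<in> carrier G"
  by (induction w) auto

lemma wval_append [simp]:
  "fst ` set u \<subseteq> carrier G \<Longrightarrow> fst ` set v \<subseteq> carrier G \<Longrightarrow> wval (u @ v) = wval u \<otimes> wval v"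
  by (induction u) (auto simp: m_assoc)

lemma wval_inv_word [simp]:
  "fst ` set w \<subseteq> carrier G \<Longrightarrow> wval (inv_word w) = inv (wval w)"
  by (induction w) (auto simp: inv_mult_group)

lemma wval_cancel:
  assumes "fst ` set (p @ s) \<subseteq> carrier G" "fst ` set q \<subseteq> carrier G"
  shows "wval (p @ s) \<otimes> wval (inv_word s @ q) = wval (p @ q)"
proof -
  have "wval p \<in> carrier G" "wval s \<in> carrier G" "wval q \<in> carrier G"
    using assms by (auto intro!: wval_closed)
  moreover have "wval (p @ s) = wval p \<otimes> wval s"
    "wval (inv_word s @ q) = inv (wval s) \<otimes> wval q" "wval (p @ q) = wval p \<otimes> wval q"
    using assms by (simp_all add: image_Un)
  ultimately show ?thesis
    by (simp add: m_assoc)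
qed

text \<open>\<open>A\<close> is arbitrary because the lemma serves both for the basis and for
  generating pairs that are not known to be free.\<close>

lemma generate_reduced_word:
  assumes "A \<subseteq> carrier G" "g \<in> generate G A"
  obtains w where "reduced_word w" "fst ` set w \<subseteq> A" "wval w = g"
proof -
  have "\<exists>w. reduced_word w \<and> fst ` set w \<subseteq> A \<and> wval w = g"
    using assms(2)
  proof (induction rule: generate.induct)
    case one
    show ?case by (intro exI[of _ "[]"]) simp
  next
    case (incl h)
    then show ?case using assms(1)
      by (intro exI[of _ "[(h, True)]"]) (auto simp: letter_value_def)
  next
    case (inv h)
    then show ?case using assms(1)
      by (intro exI[of _ "[(h, False)]"]) (auto simp: letter_value_def)
  next
    case (eng h1 h2)
    then obtain u v where u: "reduced_word u" "fst ` set u \<subseteq> A" "wval u = h1"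
      and v: "reduced_word v" "fst ` set v \<subseteq> A" "wval v = h2" by blast
    obtain p s q where psq: "u = p @ s" "v = inv_word s @ q" "reduced_word (p @ q)"
      using reduced_word_cancel[OF u(1) v(1)] .
    have A: "fst ` set (p @ s) \<subseteq> A" "fst ` set q \<subseteq> A"
      using u(2) v(2) psq by (auto simp: image_Un)
    have "wval (p @ s) \<otimes> wval (inv_word s @ q) = wval (p @ q)"
      by (rule wval_cancel) (use A assms(1) in blast)+
    then have "wval (p @ q) = h1 \<otimes> h2"
      using u(3) v(3) psq(1,2) by simp
    moreover have "fst ` set (p @ q) \<subseteq> A"
      using A by (auto simp: image_Un)
    ultimately show ?case using psq(3) by blast
  qed
  then show thesis using that by blast
qed

end

locale free_group = group +
  fixes S
  assumes basis: "free_basis G S"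
begin

lemma S_closed: "S \<subseteq> carrier G"
  and generate_S: "generate G S = carrier G"
  and reduced_trivial: "\<lbrakk>reduced_word w; fst ` set w \<subseteq> S; wval w = \<one>\<rbrakk> \<Longrightarrow> w = []"
  using basis by (auto simp: free_basis_def)

definition normal_word :: "('a \<times> bool) list \<Rightarrow> bool" where
  "normal_word w \<longleftrightarrow> reduced_word w \<and> fst ` set w \<subseteq> S"

lemma letters_closed: "normal_word w \<Longrightarrow> fst ` set w \<subseteq> carrier G"
  using S_closed by (auto simp: normal_word_def)

lemma normal_word_append_dest:
  "normal_word (u @ v) \<Longrightarrow> normal_word u \<and> normal_word v"
  by (auto simp: normal_word_def reduced_word_append)

lemma normal_inv_word [simp]: "normal_word (inv_word w) \<longleftrightarrow> normal_word w"
  by (simp add: normal_word_def)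

lemma normal_map_flip [simp]: "normal_word (map flip w) \<longleftrightarrow> normal_word w"
  by (simp add: normal_word_def image_image)

text \<open>The product of \<open>u\<close> and \<open>inv_word v\<close> reduces to
  \<open>p @ q\<close> with value \<open>\<one>\<close>; freeness makes \<open>p @ q\<close> empty,
  which leaves \<open>u = s = v\<close>.\<close>

lemma normal_word_unique:
  assumes "normal_word u" "normal_word v" "wval u = wval v"
  shows "u = v"
proof -
  have r: "reduced_word u" "reduced_word (inv_word v)"
    using assms by (auto simp: normal_word_def)
  obtain p s q where psq: "u = p @ s" "inv_word v = inv_word s @ q" "reduced_word (p @ q)"
    using reduced_word_cancel[OF r] .
  have "fst ` set (inv_word v) \<subseteq> S" using assms(2) by (simp add: normal_word_def)
  then have S: "fst ` set (p @ s) \<subseteq> S" "fst ` set q \<subseteq> S"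
    using assms(1) psq by (auto simp: normal_word_def image_Un)
  have "wval (p @ q) = wval u \<otimes> wval (inv_word v)"
    using wval_cancel[of p s q] S S_closed psq by auto
  also have "\<dots> = \<one>"
    using assms letters_closed by simp
  finally have "p @ q = []"
    using reduced_trivial[of "p @ q"] psq(3) S by auto
  then show ?thesis using psq by auto
qed

definition nf :: "'a \<Rightarrow> ('a \<times> bool) list" where
  "nf g = (THE w. normal_word w \<and> wval w = g)"

lemma nf_wval [simp]: "normal_word w \<Longrightarrow> nf (wval w) = w"
  unfolding nf_def by (rule the_equality) (auto intro: normal_word_unique)

lemma nf_props:
  assumes "g \<in> carrier G"
  shows normal_nf [simp]: "normal_word (nf g)" and wval_nf [simp]: "wval (nf g) = g"
proof -
  obtain w where "reduced_word w" "fst ` set w \<subseteq> S" "wval w = g"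
    using generate_reduced_word[OF S_closed] assms generate_S by blast
  then have "normal_word w" "wval w = g" by (auto simp: normal_word_def)
  then show "normal_word (nf g)" "wval (nf g) = g" by auto
qed

lemma nf_one [simp]: "nf \<one> = []"
  using nf_wval[of "[]"] by (simp add: normal_word_def)

lemma nf_inv [simp]: "g \<in> carrier G \<Longrightarrow> nf (inv g) = inv_word (nf g)"
  using nf_wval[of "inv_word (nf g)"] letters_closed[of "nf g"] by simp

lemma nf_generator: "s \<in> S \<Longrightarrow> nf s = [(s, True)]"
  using nf_wval[of "[(s, True)]"] S_closed
  by (auto simp: normal_word_def letter_value_def)

lemma nf_eq_Nil_iff: "g \<in> carrier G \<Longrightarrow> nf g = [] \<longleftrightarrow> g = \<one>"
  by (metis nf_one wval_nf wval_Nil)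

lemma nf_mult:
  assumes "g \<in> carrier G" "h \<in> carrier G"
  obtains p s q where "nf g = p @ s" "nf h = inv_word s @ q" "nf (g \<otimes> h) = p @ q"
    "normal_word (p @ q)" "normal_word s"
proof -
  have r: "reduced_word (nf g)" "reduced_word (nf h)"
    using assms nf_props by (auto simp: normal_word_def)
  obtain p s q where psq: "nf g = p @ s" "nf h = inv_word s @ q" "reduced_word (p @ q)"
    using reduced_word_cancel[OF r] .
  have n: "normal_word (p @ s)" "normal_word (inv_word s @ q)"
    using assms psq by (metis normal_nf)+
  then have S: "fst ` set (p @ s) \<subseteq> S" "fst ` set q \<subseteq> S"
    by (auto simp: normal_word_def image_Un)
  have pq: "normal_word (p @ q)" using psq(3) S by (auto simp: normal_word_def)
  have "wval (p @ q) = wval (nf g) \<otimes> wval (nf h)"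
    using wval_cancel[of p s q] S S_closed psq by auto
  then have "nf (g \<otimes> h) = p @ q" using nf_wval[OF pq] assms by simp
  then show thesis using that psq pq normal_word_append_dest[OF n(1)] by blast
qed

section \<open>Word length with respect to the basis\<close>

definition len :: "'a \<Rightarrow> nat" where
  "len g = length (nf g)"

lemma len_inv [simp]: "g \<in> carrier G \<Longrightarrow> len (inv g) = len g"
  by (simp add: len_def)

lemma len_eq_0_iff: "g \<in> carrier G \<Longrightarrow> len g = 0 \<longleftrightarrow> g = \<one>"
  by (simp add: len_def nf_eq_Nil_iff)

lemma len_mult_le: "g \<in> carrier G \<Longrightarrow> h \<in> carrier G \<Longrightarrow> len (g \<otimes> h) \<le> len g + len h"
  by (rule nf_mult[of g h]) (auto simp: len_def)

lemma len_wval_le: "fst ` set w \<subseteq> S \<Longrightarrow> len (wval w) \<le> length w"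
proof (induction w)
  case Nil
  then show ?case by (simp add: len_def)
next
  case (Cons l w)
  have l: "fst l \<in> S" "fst l \<in> carrier G" using Cons.prems S_closed by auto
  have "len (lval l) = 1"
    using l by (auto simp: letter_value_def len_def nf_generator)
  moreover have "len (wval (l # w)) \<le> len (lval l) + len (wval w)"
    using l Cons.prems S_closed by (auto intro!: len_mult_le)
  ultimately show ?case using Cons by auto
qed

section \<open>Invariance of the rank\<close>

text \<open>The homomorphism to the group of order two that is nontrivial exactly on those basis
  elements that lie in \<open>A\<close>; the truth value stands for the residue modulo 2.\<close>

definition parity :: "'a set \<Rightarrow> 'a \<Rightarrow> bool" where
  "parity A g \<longleftrightarrow> odd (length (filter (\<lambda>l. fst l \<in> A) (nf g)))"

lemma length_filter_inv_word:
  "length (filter (\<lambda>l. fst l \<in> A) (inv_word w)) = length (filter (\<lambda>l. fst l \<in> A) w)"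
  by (induction w) auto

lemma parity_one [simp]: "\<not> parity A \<one>"
  by (simp add: parity_def)

lemma parity_inv [simp]: "g \<in> carrier G \<Longrightarrow> parity A (inv g) = parity A g"
  by (simp add: parity_def length_filter_inv_word)

lemma parity_mult:
  "g \<in> carrier G \<Longrightarrow> h \<in> carrier G \<Longrightarrow> parity A (g \<otimes> h) \<longleftrightarrow> parity A g \<noteq> parity A h"
  by (rule nf_mult[of g h]) (auto simp: parity_def length_filter_inv_word)

lemma parity_generator: "s \<in> S \<Longrightarrow> parity A s \<longleftrightarrow> s \<in> A"
  by (simp add: parity_def nf_generator)

text \<open>Each \<open>A \<subseteq> T\<close> yields a parity homomorphism, which is determined by
  its values on \<open>X\<close> and whose values on \<open>T\<close> determine \<open>A\<close>.
  Hence \<open>2 ^ card T \<le> 2 ^ card X\<close>.\<close>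

lemma card_finite_subset_le:
  assumes "finite X" "X \<subseteq> carrier G" "generate G X = carrier G" "finite T" "T \<subseteq> S"
  shows "card T \<le> card X"
proof -
  define r where "r A = {x \<in> X. parity A x}" for A
  have "inj_on r (Pow T)"
  proof (rule inj_onI)
    fix A B assume AB: "A \<in> Pow T" "B \<in> Pow T" "r A = r B"
    have "parity A g = parity B g" if "g \<in> generate G X" for g
      using that
    proof (induction rule: generate.induct)
      case one
      show ?case by simp
    next
      case (incl h)
      then show ?case using AB(3) by (auto simp: r_def)
    next
      case (inv h)
      then have "parity A h = parity B h" "h \<in> carrier G"
        using AB(3) assms(2) by (auto simp: r_def)
      then show ?case by simp
    next
      case (eng h1 h2)
      then show ?case using assms(3) by (simp add: parity_mult)
    qed
    then have "s \<in> A \<longleftrightarrow> s \<in> B" if "s \<in> T" for s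
      using that assms(3,5) S_closed parity_generator[of s] by blast
    then show "A = B" using AB by blast
  qed
  moreover have "r ` Pow T \<subseteq> Pow X" by (auto simp: r_def)
  ultimately have "card (Pow T) \<le> card (Pow X)"
    using assms(1) by (intro card_inj_on_le) auto
  then show ?thesis using assms(1,4) by (simp add: card_Pow)
qed

lemma basis_card_le:
  assumes "finite X" "X \<subseteq> carrier G" "generate G X = carrier G"
  shows "finite S \<and> card S \<le> card X"
proof -
  have "finite S"
  proof (rule ccontr)
    assume "infinite S"
    then obtain T where "T \<subseteq> S" "finite T" "card T = Suc (card X)"
      by (meson infinite_arbitrarily_large)
    then show False using card_finite_subset_le[OF assms, of T] by simp
  qed
  then show ?thesis using card_finite_subset_le[OF assms, of S] by simp
qed

section \<open>The automorphism inverting a basis\<close>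

definition theta :: "'a \<Rightarrow> 'a" where
  "theta g = wval (map flip (nf g))"

lemma theta_closed [simp]: "g \<in> carrier G \<Longrightarrow> theta g \<in> carrier G"
  unfolding theta_def by (intro wval_closed letters_closed) simp

lemma nf_theta: "g \<in> carrier G \<Longrightarrow> nf (theta g) = map flip (nf g)"
  by (simp add: theta_def)

lemma theta_inv [simp]: "g \<in> carrier G \<Longrightarrow> theta (inv g) = inv (theta g)"
  by (simp add: theta_def map_flip_inv_word wval_inv_word[OF letters_closed])

text \<open>Flipping every letter preserves the pattern of cancellation: the flipped
  \<open>s\<close> still cancels against its inverse.\<close>

lemma theta_mult [simp]:
  assumes "g \<in> carrier G" "h \<in> carrier G"
  shows "theta (g \<otimes> h) = theta g \<otimes> theta h"
proof -
  obtain p s q where e: "nf g = p @ s" "nf h = inv_word s @ q" "nf (g \<otimes> h) = p @ q"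
    "normal_word (p @ q)" "normal_word s"
    using nf_mult[OF assms] .
  have "fst ` set p \<subseteq> carrier G" "fst ` set q \<subseteq> carrier G" "fst ` set s \<subseteq> carrier G"
    using e(4,5) letters_closed[of "p @ q"] letters_closed[of s] by (auto simp: image_Un)
  then have "wval (map flip p @ map flip s) \<otimes> wval (inv_word (map flip s) @ map flip q) =
      wval (map flip p @ map flip q)"
    by (intro wval_cancel) (auto simp: image_Un image_image)
  then show ?thesis by (simp add: theta_def e map_flip_inv_word)
qed

lemma theta_generator: "s \<in> S \<Longrightarrow> theta s = inv s"
  using S_closed by (auto simp: theta_def nf_generator letter_value_def flip_def)

section \<open>Pairs inverted by \<open>theta\<close> up to a common conjugation\<close>

definition inverted_by :: "'a \<Rightarrow> 'a \<Rightarrow> bool" where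
  "inverted_by c g \<longleftrightarrow> theta g = c \<otimes> inv g \<otimes> inv c"

text \<open>One \<open>c\<close> serves both elements: \<open>theta\<close> followed by the map from
  \<open>z\<close> to \<open>inv c \<otimes> z \<otimes> c\<close> is an automorphism that inverts
  \<open>g\<close> and \<open>h\<close> at once.\<close>

definition coinverted :: "'a \<Rightarrow> 'a \<Rightarrow> bool" where
  "coinverted g h \<longleftrightarrow> (\<exists>c\<in>carrier G. inverted_by c g \<and> inverted_by c h)"

lemma inverted_by_inv:
  assumes "c \<in> carrier G" "g \<in> carrier G" "inverted_by c g"
  shows "inverted_by c (inv g)"
  using assms by (simp add: inverted_by_def inv_mult_group m_assoc)

lemma inverted_by_inv_iff:
  assumes "c \<in> carrier G" "g \<in> carrier G"
  shows "inverted_by c (inv g) \<longleftrightarrow> inverted_by c g"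
  using inverted_by_inv[of c g] inverted_by_inv[of c "inv g"] assms by auto

lemma coinverted_sym: "coinverted g h \<Longrightarrow> coinverted h g"
  by (auto simp: coinverted_def)

lemma coinverted_mult:
  assumes "g \<in> carrier G" "h \<in> carrier G" "coinverted g h"
  shows "coinverted g (g \<otimes> h)"
proof -
  obtain c where c: "c \<in> carrier G" "inverted_by c g" "inverted_by c h"
    using assms(3) by (auto simp: coinverted_def)
  \<comment> \<open>Since \<open>theta (g \<otimes> h) = c \<otimes> inv g \<otimes> inv h \<otimes>
    inv c\<close>, moving the factor \<open>inv g\<close> into the conjugator reverses the order of
    the two inverses.\<close>
  then have "inverted_by (c \<otimes> inv g) g \<and> inverted_by (c \<otimes> inv g) (g \<otimes> h)"
    using assms by (simp add: inverted_by_def inv_mult_group m_assoc)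
  then show ?thesis using c assms unfolding coinverted_def by blast
qed

lemma coinverted_inv:
  assumes "g \<in> carrier G" "h \<in> carrier G" "coinverted g h"
  shows "coinverted (inv g) h"
  using assms inverted_by_inv unfolding coinverted_def by blast

text \<open>Multiplying by \<open>inv g\<close> undoes the Nielsen move. This direction lets the
  failure of \<open>coinverted\<close> pass from \<open>g, h\<close> to
  \<open>g, g \<otimes> h\<close>.\<close>

lemma coinverted_mult_dest:
  assumes "g \<in> carrier G" "h \<in> carrier G" "coinverted g (g \<otimes> h)"
  shows "coinverted g h"
proof -
  have "coinverted (inv g) (inv g \<otimes> (g \<otimes> h))"
    using assms by (intro coinverted_mult[of "inv g"] coinverted_inv[of g]) auto
  then have "coinverted (inv g) h" using assms by simp
  then have "coinverted (inv (inv g)) h" using assms(1,2) by (intro coinverted_inv[of "inv g"]) auto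
  then show ?thesis using assms(1) by simp
qed

text \<open>Applying \<open>theta\<close> to the conjugates and moving \<open>theta v\<close> to the
  other side turns the witness \<open>c\<close> into
  \<open>inv (theta v) \<otimes> c \<otimes> v\<close>.\<close>

lemma coinverted_conj:
  assumes "g \<in> carrier G" "h \<in> carrier G" "v \<in> carrier G"
    "coinverted (v \<otimes> g \<otimes> inv v) (v \<otimes> h \<otimes> inv v)"
  shows "coinverted g h"
proof -
  obtain c where c: "c \<in> carrier G" "inverted_by c (v \<otimes> g \<otimes> inv v)" "inverted_by c (v \<otimes> h \<otimes> inv v)"
    using assms(4) by (auto simp: coinverted_def)
  have *: "inverted_by (inv (theta v) \<otimes> c \<otimes> v) z"
    if z: "z \<in> carrier G" "inverted_by c (v \<otimes> z \<otimes> inv v)" for z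
  proof -
    have eq: "theta v \<otimes> theta z \<otimes> inv (theta v) = c \<otimes> inv (v \<otimes> z \<otimes> inv v) \<otimes> inv c"
      using z assms(3) by (simp add: inverted_by_def)
    have "theta z = inv (theta v) \<otimes> (theta v \<otimes> theta z \<otimes> inv (theta v)) \<otimes> theta v"
      using z(1) assms(3) by (simp add: m_assoc)
    also have "\<dots> = inv (theta v) \<otimes> (c \<otimes> inv (v \<otimes> z \<otimes> inv v) \<otimes> inv c) \<otimes> theta v"
      by (simp only: eq)
    also have "\<dots> = (inv (theta v) \<otimes> c \<otimes> v) \<otimes> inv z \<otimes> inv (inv (theta v) \<otimes> c \<otimes> v)"
      using z(1) assms(3) c(1) by (simp add: inv_mult_group m_assoc)
    finally show ?thesis by (simp add: inverted_by_def)
  qed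
  show ?thesis
    unfolding coinverted_def using *[OF assms(1) c(2)] *[OF assms(2) c(3)] c(1) assms(3)
    by (intro bexI[of _ "inv (theta v) \<otimes> c \<otimes> v"]) auto
qed

section \<open>Cancellation in minimal generating pairs\<close>

text \<open>The cancelled part \<open>s\<close> is shorter than half of \<open>nf g\<close>, and the
  square has length \<open>2 * len g - 2 * length s\<close>.\<close>

lemma len_square:
  assumes "g \<in> carrier G" "g \<noteq> \<one>"
  shows "len g < len (g \<otimes> g)"
proof -
  obtain p s q where e: "nf g = p @ s" "nf g = inv_word s @ q" "nf (g \<otimes> g) = p @ q"
    using nf_mult[OF assms(1) assms(1)] by blast
  have "reduced_word (nf g)" "nf g \<noteq> []"
    using assms nf_props by (auto simp: normal_word_def nf_eq_Nil_iff)
  then have "2 * length s < length (nf g)" using reduced_self_cancel e(1,2) by blast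
  moreover have "length (nf g) = length p + length s" using e(1) by simp
  moreover have "length (nf g) = length s + length q" using e(2) by simp
  ultimately show ?thesis unfolding len_def e(3) by simp
qed

text \<open>The length conditions say that half of \<open>nf h\<close> cancels in each product. So
  both halves of \<open>nf h\<close> come from the same ending \<open>s\<close> of
  \<open>nf g\<close>, and \<open>nf h = inv_word s @ s\<close> is reduced only if it is
  empty.\<close>

lemma half_cancel_inverse:
  assumes g: "g \<in> carrier G" and h: "h \<in> carrier G"
    and eq: "len (g \<otimes> h) = len g" "len (h \<otimes> inv g) = len g"
  shows "h = \<one>"
proof -
  obtain p s q where e: "nf g = p @ s" "nf h = inv_word s @ q" "nf (g \<otimes> h) = p @ q"
    using nf_mult[OF g h] by blast
  obtain p' s' q' where e': "nf h = p' @ s'" "nf (inv g) = inv_word s' @ q'"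
    "nf (h \<otimes> inv g) = p' @ q'"
    using nf_mult[OF h inv_closed[OF g]] by blast
  have g': "nf g = inv_word q' @ s'"
    using arg_cong[OF e'(2), of inv_word] g by simp
  have l: "length p + length q = length p + length s" 
    using eq(1) unfolding len_def e(3) e(1) by simp
  have l': "length p' + length q' = length q' + length s'"
    using eq(2) unfolding len_def e'(3) g' by simp
  have "length (inv_word s @ q) = length (p' @ s')" using e(2) e'(1) by simp
  then have "length s = length s'" using l l' by simp
  then have "s = s'" using e(1) g' by simp
  moreover have "inv_word s @ q = p' @ s'" using e(2) e'(1) by simp
  ultimately have ip: "inv_word s = p'" using l l' by (simp add: append_eq_append_conv)
  have "nf h = inv_word s @ inv_word (inv_word s)"
    using e'(1) ip \<open>s = s'\<close> by (metis inv_word_simps(4))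
  moreover have "reduced_word (nf h)" using normal_nf[OF h] by (simp add: normal_word_def)
  ultimately have "reduced_word (inv_word s @ inv_word (inv_word s))" by (simp only:)
  then have "inv_word s = []" by (rule reduced_append_inv_word)
  then have "nf h = []" using \<open>nf h = inv_word s @ inv_word (inv_word s)\<close> by simp
  then show ?thesis using h by (simp add: nf_eq_Nil_iff)
qed

section \<open>Minimal counterexamples under Nielsen moves and conjugation\<close>

definition bad_pair :: "'a \<Rightarrow> 'a \<Rightarrow> bool" where
  "bad_pair u v \<longleftrightarrow> u \<in> carrier G \<and> v \<in> carrier G \<and> generate G {u, v} = carrier G \<and> \<not> coinverted u v"

text \<open>Nielsen moves and conjugation preserve \<open>bad_pair\<close>, so none of them can
  shorten such a pair.\<close>

definition minimal_bad_pair :: "'a \<Rightarrow> 'a \<Rightarrow> bool" where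
  "minimal_bad_pair u v \<longleftrightarrow>
     bad_pair u v \<and> (\<forall>u' v'. bad_pair u' v' \<longrightarrow> len u + len v \<le> len u' + len v')"

lemma generate_eq_carrierI:
  assumes "A \<subseteq> carrier G" "generate G A = carrier G" "B \<subseteq> carrier G" "A \<subseteq> generate G B"
  shows "generate G B = carrier G"
  using generate_subgroup_incl[OF assms(4) generate_is_subgroup[OF assms(3)]]
    assms(2) generate_incl[OF assms(3)] by auto

lemma bad_pair_sym: "bad_pair u v \<Longrightarrow> bad_pair v u"
  by (auto simp: bad_pair_def insert_commute dest: coinverted_sym)

lemma bad_pair_inv:
  assumes "bad_pair u v"
  shows "bad_pair (inv u) v"
proof -
  have c: "u \<in> carrier G" "v \<in> carrier G" and n: "\<not> coinverted u v"
    and g: "generate G {u, v} = carrier G"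
    using assms by (auto simp: bad_pair_def)
  have "inv (inv u) \<in> generate G {inv u, v}" by (rule generate.inv) simp
  then have "{u, v} \<subseteq> generate G {inv u, v}"
    using c by (auto intro: generate.incl)
  then have "generate G {inv u, v} = carrier G"
    using c by (intro generate_eq_carrierI[OF _ g]) auto
  moreover have "\<not> coinverted (inv u) v"
    using coinverted_inv[of "inv u" v] c n by auto
  ultimately show ?thesis using c by (simp add: bad_pair_def)
qed

lemma bad_pair_mult:
  assumes "bad_pair u v"
  shows "bad_pair u (u \<otimes> v)"
proof -
  have c: "u \<in> carrier G" "v \<in> carrier G" and n: "\<not> coinverted u v"
    and g: "generate G {u, v} = carrier G"
    using assms by (auto simp: bad_pair_def)
  have "inv u \<otimes> (u \<otimes> v) \<in> generate G {u, u \<otimes> v}"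
    by (rule generate.eng) (auto intro: generate.incl generate.inv)
  then have "{u, v} \<subseteq> generate G {u, u \<otimes> v}"
    using c by (auto intro: generate.incl)
  then have "generate G {u, u \<otimes> v} = carrier G"
    using c by (intro generate_eq_carrierI[OF _ g]) auto
  then show ?thesis using c n coinverted_mult_dest by (auto simp: bad_pair_def)
qed

lemma bad_pair_conj:
  assumes "bad_pair u v" "w \<in> carrier G"
  shows "bad_pair (w \<otimes> u \<otimes> inv w) (w \<otimes> v \<otimes> inv w)"
proof -
  have c: "u \<in> carrier G" "v \<in> carrier G" and n: "\<not> coinverted u v"
    and g: "generate G {u, v} = carrier G"
    using assms by (auto simp: bad_pair_def)
  let ?H = "generate G {w \<otimes> u \<otimes> inv w, w \<otimes> v \<otimes> inv w}"
  have conj: "w \<otimes> z \<otimes> inv w \<in> ?H" if "z \<in> generate G {u, v}" for z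
    using that
  proof (induction rule: generate.induct)
    case one
    then show ?case using assms(2) by (simp add: generate.one)
  next
    case (incl h)
    then show ?case by (auto intro: generate.incl)
  next
    case (inv h)
    then have "inv (w \<otimes> h \<otimes> inv w) \<in> ?H" "h \<in> carrier G"
      using c by (auto intro: generate.inv)
    then show ?case using assms(2) by (simp add: inv_mult_group m_assoc)
  next
    case (eng h1 h2)
    then have "h1 \<in> carrier G" "h2 \<in> carrier G" using g by auto
    then have "w \<otimes> (h1 \<otimes> h2) \<otimes> inv w = (w \<otimes> h1 \<otimes> inv w) \<otimes> (w \<otimes> h2 \<otimes> inv w)"
      using assms(2) by (simp add: m_assoc)
    then show ?case using eng generate.eng by simp
  qed
  \<comment> \<open>Every \<open>z\<close> is the conjugate by \<open>w\<close> of
    \<open>inv w \<otimes> z \<otimes> w\<close>, which the old pair generates.\<close>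
  have "z \<in> ?H" if z: "z \<in> carrier G" for z
  proof -
    have "inv w \<otimes> z \<otimes> w \<in> generate G {u, v}" using g z assms(2) by simp
    from conj[OF this] show ?thesis using z assms(2) by (simp add: m_assoc)
  qed
  moreover have "?H \<subseteq> carrier G" using c assms(2) by (intro generate_incl) auto
  ultimately have "?H = carrier G" by blast
  then show ?thesis
    using c n assms(2) coinverted_conj[OF c assms(2)] by (auto simp: bad_pair_def)
qed

lemma minimal_bad_pairD:
  assumes "minimal_bad_pair u v"
  shows "bad_pair u v" "u \<in> carrier G" "v \<in> carrier G"
    "bad_pair u' v' \<Longrightarrow> len u + len v \<le> len u' + len v'"
  using assms by (auto simp: minimal_bad_pair_def bad_pair_def)

lemma minimal_bad_pair_sym: "minimal_bad_pair u v \<Longrightarrow> minimal_bad_pair v u"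
  using bad_pair_sym by (auto simp: minimal_bad_pair_def add.commute)

lemma minimal_bad_pair_inv: "minimal_bad_pair u v \<Longrightarrow> minimal_bad_pair (inv u) v"
  using bad_pair_inv minimal_bad_pairD(2)[of u v] by (auto simp: minimal_bad_pair_def)

text \<open>Reduces letters with arbitrary signs to the case of a minimal pair itself.\<close>

lemma minimal_bad_pair_lval:
  assumes "minimal_bad_pair a b" "fst l \<in> {a, b}" "fst m \<in> {a, b}" "fst l \<noteq> fst m"
  shows "minimal_bad_pair (lval l) (lval m)"
proof -
  have "minimal_bad_pair (fst l) (fst m)"
    using assms minimal_bad_pair_sym by auto
  then have "minimal_bad_pair (lval l) (fst m)"
    using minimal_bad_pair_inv by (auto simp: letter_value_def)
  then show ?thesis
    using minimal_bad_pair_inv minimal_bad_pair_sym unfolding letter_value_def by metis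
qed

text \<open>The Nielsen move that replaces \<open>v\<close> by \<open>u \<otimes> v\<close> cannot
  shorten a minimal pair.\<close>

lemma minimal_bad_pair_len_mult:
  assumes "minimal_bad_pair u v"
  shows "len u \<le> len (u \<otimes> v)" "len v \<le> len (u \<otimes> v)"
proof -
  have *: "len v \<le> len (u \<otimes> v)" if "minimal_bad_pair u v" for u v
    using minimal_bad_pairD(4)[OF that bad_pair_mult[OF minimal_bad_pairD(1)[OF that]]] by simp
  then show "len v \<le> len (u \<otimes> v)" using assms .
  have c: "u \<in> carrier G" "v \<in> carrier G" using minimal_bad_pairD[OF assms] by auto
  \<comment> \<open>The inverses in swapped order have the product
    \<open>inv (u \<otimes> v)\<close>, which transfers the bound to the other factor.\<close>
  have "minimal_bad_pair (inv v) (inv u)"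
    using assms by (intro minimal_bad_pair_inv minimal_bad_pair_sym[OF minimal_bad_pair_inv])
  from *[OF this] have "len (inv u) \<le> len (inv (u \<otimes> v))"
    using c by (simp add: inv_mult_group)
  then show "len u \<le> len (u \<otimes> v)" using c by simp
qed

end

section \<open>Reduction of generating pairs in rank two\<close>

locale free_group_rank2 = free_group +
  assumes rank: "card S = 2"
begin

text \<open>Otherwise a single element would generate the group, against the invariance of the
  rank.\<close>

lemma generating_pair_distinct:
  assumes "a \<in> carrier G" "b \<in> carrier G" "generate G {a, b} = carrier G"
  shows "a \<noteq> \<one>" "b \<noteq> \<one>" "a \<noteq> b"
proof -
  have cyc: "generate G {z} \<noteq> carrier G" if "z \<in> carrier G" for z
    using basis_card_le[of "{z}"] that rank by auto
  have "generate G {c} = carrier G" if "{c, \<one>} = {a, b}" for c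
    using that assms(1,2)
    by (intro generate_eq_carrierI[OF _ assms(3)]) (auto intro: generate.incl generate.one)
  then show "a \<noteq> \<one>" "b \<noteq> \<one>" "a \<noteq> b"
    using cyc assms by (metis insert_commute insert_absorb2)+
qed

lemma minimal_bad_pair_nontrivial:
  assumes "minimal_bad_pair u v"
  shows "u \<noteq> \<one>" "v \<noteq> \<one>" "u \<noteq> v"
  using generating_pair_distinct[of u v] assms
  by (auto simp: minimal_bad_pair_def bad_pair_def)

text \<open>Here conjugation is needed besides the Nielsen moves: if both products lose exactly half of
  \<open>v = s\<^sup>-\<^sup>1 q\<close>, then \<open>u = q\<^sup>-\<^sup>1 m s\<close>, and conjugating the pair \<open>v, v u\<close> by \<open>s\<close> gives the
  shorter pair \<open>q s\<^sup>-\<^sup>1, m\<close>.\<close>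

lemma minimal_bad_pair_half_cancel:
  assumes min: "minimal_bad_pair u v"
  shows "\<not> (len (u \<otimes> v) = len u \<and> len (v \<otimes> u) = len u)"
proof
  assume eq: "len (u \<otimes> v) = len u \<and> len (v \<otimes> u) = len u"
  note D = minimal_bad_pairD[OF min]
  note u = D(2) and v = D(3)
  obtain p s q where e: "nf u = p @ s" "nf v = inv_word s @ q" "nf (u \<otimes> v) = p @ q"
    "normal_word s"
    using nf_mult[OF u v] by blast
  obtain p' s' q' where e': "nf v = p' @ s'" "nf u = inv_word s' @ q'" "nf (v \<otimes> u) = p' @ q'"
    using nf_mult[OF v u] by blast
  have l: "length q = length s" using eq unfolding len_def e(3) e(1) by simp
  have l': "length p' = length s'" using eq unfolding len_def e'(3) e'(2) by simp
  have vv: "inv_word s @ q = p' @ s'" using e(2) e'(1) by simp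
  then have "length (inv_word s @ q) = length (p' @ s')" by simp
  then have "length s = length s'" using l l' by simp
  then have s': "s' = q" using vv l by simp
  \<comment> \<open>This bound keeps the two pieces of \<open>nf u\<close> that cancel, the prefix
    \<open>inv_word q\<close> and the suffix \<open>s\<close>, from overlapping; \<open>m\<close> is
    what lies between them.\<close>
  have "len v \<le> len u" using minimal_bad_pair_len_mult(2)[OF min] eq by simp
  then have "length s + length q \<le> length p + length s"
    unfolding len_def e(1) e(2) by simp
  moreover have pq: "p @ s = inv_word q @ q'" using e(1) e'(2) s' by simp
  ultimately have p: "p = inv_word q @ drop (length q) p"
    by (metis append_eq_append_conv_if append_take_drop_id inv_word_simps(5)
        add.commute nat_add_left_cancel_le)
  define m where "m = drop (length q) p"
  have nu: "nf u = inv_word q @ m @ s" using e(1) p by (simp add: m_def)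
  have n: "normal_word (inv_word q @ m @ s)" "normal_word (inv_word s @ q)"
    using nu e(2) u v by (metis normal_nf)+
  then have S: "fst ` set s \<subseteq> S" "fst ` set q \<subseteq> S" "fst ` set m \<subseteq> S"
    by (auto simp: normal_word_def image_Un)
  then have C: "fst ` set s \<subseteq> carrier G" "fst ` set q \<subseteq> carrier G" "fst ` set m \<subseteq> carrier G"
    using S_closed by auto
  then have c: "wval s \<in> carrier G" "wval q \<in> carrier G" "wval m \<in> carrier G" by simp_all
  have vw: "v = inv (wval s) \<otimes> wval q"
    using wval_nf[OF v] C unfolding e(2) by simp
  have uw: "u = inv (wval q) \<otimes> (wval m \<otimes> wval s)"
    using wval_nf[OF u] C unfolding nu by (simp add: image_Un)
  have cv: "wval s \<otimes> v \<otimes> inv (wval s) = wval (q @ inv_word s)"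
    using c C by (simp add: vw m_assoc)
  have cvu: "wval s \<otimes> (v \<otimes> u) \<otimes> inv (wval s) = wval m"
    using c C by (simp add: vw uw m_assoc)
  have "bad_pair (wval (q @ inv_word s)) (wval m)"
    using bad_pair_conj[OF bad_pair_mult[OF bad_pair_sym[OF D(1)]] c(1)] by (simp only: cv cvu)
  \<comment> \<open>The conjugated pair has total length at most \<open>len u\<close>, so minimality
    leaves no length for \<open>v\<close>.\<close>
  then have "len u + len v \<le> len (wval (q @ inv_word s)) + len (wval m)" by (rule D(4))
  also have "\<dots> \<le> length (q @ inv_word s) + length m"
    using S by (intro add_mono len_wval_le) (auto simp: image_Un)
  also have "\<dots> = len u"
    unfolding len_def nu by simp
  finally have "len v = 0" by simp
  then show False using v minimal_bad_pair_nontrivial[OF min] by (simp add: len_eq_0_iff)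
qed

text \<open>Letters over different elements of the pair are governed by the Nielsen move. Letters
  over the same element that are not mutually inverse coincide, and a square is strictly
  longer.\<close>

lemma letter_len_mult:
  assumes min: "minimal_bad_pair a b" and "fst l \<in> {a, b}" "fst m \<in> {a, b}" "m \<noteq> flip l"
  shows "len (lval l) \<le> len (lval l \<otimes> lval m)" "len (lval m) \<le> len (lval l \<otimes> lval m)"
    "fst l = fst m \<Longrightarrow> len (lval l) < len (lval l \<otimes> lval m)" "0 < len (lval l)"
proof -
  have c: "fst l \<in> carrier G" "fst l \<noteq> \<one>"
    using assms minimal_bad_pairD[OF min] minimal_bad_pair_nontrivial[OF min] by auto
  then have l: "lval l \<in> carrier G" "lval l \<noteq> \<one>"
    by (auto simp: letter_value_def)
  then show "0 < len (lval l)" using len_eq_0_iff by blast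
  have same: "len (lval l) < len (lval l \<otimes> lval m) \<and> lval m = lval l" if "fst l = fst m"
  proof -
    have "m = l" using assms(4) that by (auto simp: flip_def prod_eq_iff)
    then show ?thesis using len_square[OF l] by simp
  qed
  then show "fst l = fst m \<Longrightarrow> len (lval l) < len (lval l \<otimes> lval m)" by blast
  have "len (lval l) \<le> len (lval l \<otimes> lval m) \<and> len (lval m) \<le> len (lval l \<otimes> lval m)"
  proof (cases "fst l = fst m")
    case True
    then show ?thesis using same by auto
  next
    case False
    then show ?thesis
      using minimal_bad_pair_len_mult[OF minimal_bad_pair_lval[OF assms(1-3)]] by blast
  qed
  then show "len (lval l) \<le> len (lval l \<otimes> lval m)" "len (lval m) \<le> len (lval l \<otimes> lval m)"
    by blast+
qed

text \<open>A product of length \<open>n\<close> of elements of lengths \<open>i\<close> and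
  \<open>j\<close> loses \<open>(i + j - n) / 2\<close> letters from each factor, so the inequality
  says that the neighbours do not consume \<open>lval l\<close> entirely. Each takes at most half.
  If both took exactly half, \<open>k\<close> and \<open>m\<close> would lie over the same element,
  different from that of \<open>l\<close>; equal signs contradict
  \<open>minimal_bad_pair_half_cancel\<close>, opposite signs
  \<open>half_cancel_inverse\<close>.\<close>

lemma three_letter_cancel:
  assumes min: "minimal_bad_pair a b"
    and f: "fst k \<in> {a, b}" "fst l \<in> {a, b}" "fst m \<in> {a, b}"
    and red: "l \<noteq> flip k" "m \<noteq> flip l"
  shows "len (lval k) + len (lval m) < len (lval k \<otimes> lval l) + len (lval l \<otimes> lval m)"
proof (rule ccontr)
  assume neg: "\<not> ?thesis"
  note kl = letter_len_mult[OF min f(1,2) red(1)]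
  note lm = letter_len_mult[OF min f(2,3) red(2)]
  have eq: "len (lval k \<otimes> lval l) = len (lval k)" "len (lval l \<otimes> lval m) = len (lval m)"
    using neg kl(1) lm(2) by auto
  then have kl': "fst k \<noteq> fst l" using kl(3) by auto
  have "fst l \<noteq> fst m"
  proof
    assume "fst l = fst m"
    moreover from this have "m = l" using red(2) by (auto simp: flip_def prod_eq_iff)
    ultimately show False using lm(3) eq by auto
  qed
  then have km: "fst k = fst m" using f kl' by auto
  have c: "fst k \<in> carrier G" "fst l \<in> carrier G"
    using f minimal_bad_pairD[OF min] by auto
  have M: "minimal_bad_pair (lval k) (lval l)"
    using minimal_bad_pair_lval[OF min f(1,2) kl'] .
  show False
  proof (cases "m = k")
    case True
    then show False using minimal_bad_pair_half_cancel[OF M] eq by simp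
  next
    case False
    then have "m = flip k" using km by (auto simp: flip_def prod_eq_iff)
    then have "len (lval l \<otimes> inv (lval k)) = len (lval k)" using eq(2) c by simp
    then have "lval l = \<one>" using half_cancel_inverse[OF _ _ eq(1)] c by simp
    then show False using minimal_bad_pair_nontrivial[OF M] by simp
  qed
qed

text \<open>\<open>r\<close> is the ending of \<open>nf (lval l)\<close> that survives in the
  product, and the inequality says that any admissible next letter cancels less than all of
  \<open>r\<close>. So each new factor leaves part of its predecessor behind, which makes
  \<open>q\<close> grow.\<close>

lemma normal_form_of_product:
  assumes min: "minimal_bad_pair a b"
    and "reduced_word (w @ [l])" "fst ` set (w @ [l]) \<subseteq> {a, b}"
  shows "\<exists>q r p. nf (wval (w @ [l])) = q @ r \<and> nf (lval l) = p @ r \<and> length w \<le> length q \<and>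
    (\<forall>m. fst m \<in> {a, b} \<longrightarrow> m \<noteq> flip l \<longrightarrow>
       len (lval l) + len (lval m) < len (lval l \<otimes> lval m) + 2 * length r)"
  using assms(2,3)
proof (induction w arbitrary: l rule: rev_induct)
  case Nil
  have l: "fst l \<in> {a, b}" using Nil.prems by simp
  then have c: "lval l \<in> carrier G" using minimal_bad_pairD[OF min] by auto
  have "len (lval l) + len (lval m) < len (lval l \<otimes> lval m) + 2 * length (nf (lval l))"
    if "fst m \<in> {a, b}" "m \<noteq> flip l" for m
    using letter_len_mult(2,4)[OF min l that] unfolding len_def[symmetric] by linarith
  \<comment> \<open>For a single letter everything survives: \<open>r\<close> is the whole normal
    form, \<open>q\<close> and \<open>p\<close> are empty.\<close>
  then show ?case
    using c by - (rule exI[of _ "[]"], rule exI[of _ "nf (lval l)"], rule exI[of _ "[]"], simp)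
next
  case (snoc k w)
  have ab: "{a, b} \<subseteq> carrier G" using minimal_bad_pairD[OF min] by auto
  have k: "fst k \<in> {a, b}" and l: "fst l \<in> {a, b}" and w: "fst ` set w \<subseteq> {a, b}"
    using snoc.prems(2) by auto
  have red: "reduced_word (w @ [k])" and kl: "l \<noteq> flip k"
    using snoc.prems(1) by (simp_all add: reduced_word_append reduced_word_Cons)
  have wk: "fst ` set (w @ [k]) \<subseteq> {a, b}" using k w by simp
  from snoc.IH[OF red wk] obtain q r p
    where IH: "nf (wval (w @ [k])) = q @ r" "nf (lval k) = p @ r" "length w \<le> length q"
      "len (lval k) + len (lval l) < len (lval k \<otimes> lval l) + 2 * length r"
    using l kl by blast
  have wkC: "fst ` set (w @ [k]) \<subseteq> carrier G" and lC: "fst ` set [l] \<subseteq> carrier G"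
    using wk ab l by auto
  have c: "lval k \<in> carrier G" "lval l \<in> carrier G" "wval (w @ [k]) \<in> carrier G"
    using wval_closed[OF wkC] wkC lC by simp_all
  obtain p' s t where e: "nf (lval k) = p' @ s" "nf (lval l) = inv_word s @ t"
    "nf (lval k \<otimes> lval l) = p' @ t" "normal_word (p' @ t)"
    using nf_mult[OF c(1,2)] by blast
  \<comment> \<open>The part \<open>s\<close> cancelled by the new letter is shorter than
    \<open>r\<close>, so a nonempty \<open>r'\<close> remains between \<open>q\<close> and
    \<open>t\<close>.\<close>
  have "length s < length r"
    using IH(4) unfolding len_def e by simp
  moreover have "p @ r = p' @ s" using IH(2) e(1) by simp
  ultimately obtain r' where r': "r = r' @ s" "p' = p @ r'"
    by (auto simp: append_eq_append_conv2)
  with \<open>length s < length r\<close> have "r' \<noteq> []" by auto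
  have n1: "normal_word (q @ r' @ s)" using IH(1) r'(1) c(3) by (metis normal_nf)
  have n2: "normal_word (p @ r' @ t)" using e(4) r'(2) by simp
  \<comment> \<open>The nonempty \<open>r'\<close> keeps \<open>q\<close> and \<open>t\<close>
    apart, so reducedness can be read off from \<open>q @ r' @ s\<close> and
    \<open>p @ r' @ t\<close>.\<close>
  have n: "normal_word ((q @ r') @ t)"
    using n1 n2 \<open>r' \<noteq> []\<close> by (auto simp: normal_word_def reduced_word_append)
  have C: "fst ` set (q @ r' @ s) \<subseteq> carrier G" "fst ` set t \<subseteq> carrier G"
    using letters_closed[OF n1] letters_closed[OF n] by (auto simp: image_Un)
  have "wval ((w @ [k]) @ [l]) = wval (w @ [k]) \<otimes> lval l"
    by (subst wval_append[OF wkC lC]) (use c in simp)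
  also have "\<dots> = wval ((q @ r') @ s) \<otimes> wval (inv_word s @ t)"
    using wval_nf[OF c(3)] wval_nf[OF c(2)] IH(1) e(2) r'(1) by simp
  also have "\<dots> = wval ((q @ r') @ t)"
    by (rule wval_cancel) (use C in auto)
  finally have nf: "nf (wval ((w @ [k]) @ [l])) = (q @ r') @ t" using n by simp
  have len: "length (w @ [k]) \<le> length (q @ r')"
    using IH(3) \<open>r' \<noteq> []\<close> by (cases r') auto
  have "len (lval l) + len (lval m) < len (lval l \<otimes> lval m) + 2 * length t"
    if "fst m \<in> {a, b}" "m \<noteq> flip l" for m
  proof -
    \<comment> \<open>Substituting these lengths turns \<open>three_letter_cancel\<close> into the
      required bound for \<open>t\<close>.\<close>
    have "len (lval k) = length p' + length s" "len (lval l) = length s + length t"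
      "len (lval k \<otimes> lval l) = length p' + length t"
      unfolding len_def e by simp_all
    then show ?thesis using three_letter_cancel[OF min k l that(1) kl that(2)] by simp
  qed
  then show ?case using nf e(2) len by blast
qed

lemma length_le_len_wval:
  assumes min: "minimal_bad_pair a b" and w: "reduced_word w" "fst ` set w \<subseteq> {a, b}"
  shows "length w \<le> len (wval w)"
proof (cases w rule: rev_cases)
  case (snoc v l)
  have l: "fst l \<in> {a, b}" using w snoc by simp
  obtain q r where e: "nf (wval w) = q @ r" "length v \<le> length q"
    and cancel: "\<And>m. fst m \<in> {a, b} \<Longrightarrow> m \<noteq> flip l \<Longrightarrow>
      len (lval l) + len (lval m) < len (lval l \<otimes> lval m) + 2 * length r"
    using normal_form_of_product[OF min, of v l] w unfolding snoc by blast
  have "lval l \<in> carrier G" using l minimal_bad_pairD[OF min] by auto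
  \<comment> \<open>For empty \<open>r\<close>, the choice \<open>m = l\<close> in
    \<open>cancel\<close> would contradict the subadditivity of \<open>len\<close>.\<close>
  then have "r \<noteq> []" using cancel[OF l] len_mult_le[of "lval l" "lval l"] by auto
  then have "1 \<le> length r" by (cases r) auto
  then show ?thesis using e(1,2) snoc by (simp add: len_def)
qed simp

text \<open>Basis elements have length 1, so by \<open>length_le_len_wval\<close> each of them is
  \<open>a\<close>, \<open>b\<close> or an inverse of one. Hence the pair agrees with the basis up
  to inverses, and \<open>c = \<one>\<close> shows that it is coinverted.\<close>

lemma no_minimal_bad_pair: "\<not> minimal_bad_pair a b"
proof
  assume min: "minimal_bad_pair a b"
  note D = minimal_bad_pairD[OF min]
  have gen: "generate G {a, b} = carrier G" using D(1) by (simp add: bad_pair_def)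
  have letter: "\<exists>l. fst l \<in> {a, b} \<and> z = lval l" if z: "z \<in> S" for z
  proof -
    have zc: "z \<in> generate G {a, b}" using z S_closed gen by auto
    obtain w where w: "reduced_word w" "fst ` set w \<subseteq> {a, b}" "wval w = z"
      using generate_reduced_word[OF _ zc] D(2,3) by blast
    have "length w \<le> 1"
      using length_le_len_wval[OF min w(1,2)] nf_generator[OF z] w(3) by (simp add: len_def)
    moreover have "w \<noteq> []" using w(3) nf_generator[OF z] by auto
    ultimately obtain l where l: "w = [l]" by (cases w) auto
    then have "fst l \<in> carrier G" using w(2) D(2,3) by auto
    then show ?thesis using w l by (intro exI[of _ l]) auto
  qed
  obtain x y where xy: "S = {x, y}" "x \<noteq> y" using rank by (auto simp: card_2_iff)
  have xS: "x \<in> S" and yS: "y \<in> S" using xy by auto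
  obtain l m where l: "fst l \<in> {a, b}" "x = lval l" and m: "fst m \<in> {a, b}" "y = lval m"
    using letter[OF xS] letter[OF yS] by blast
  have inverted: "inverted_by \<one> (fst k)" if "fst k \<in> carrier G" "lval k \<in> S" for k
  proof -
    have "inverted_by \<one> (lval k)"
      using that by (simp add: inverted_by_def theta_generator)
    then show ?thesis using that inverted_by_inv_iff by (auto simp: letter_value_def split: if_splits)
  qed
  \<comment> \<open>Excludes that \<open>x\<close> and \<open>y\<close> are mutually inverse letters
    over one element of the pair.\<close>
  have "nf x \<noteq> inv_word (nf y)" using xS yS by (simp add: nf_generator flip_def)
  then have "x \<noteq> inv y" using yS S_closed by (metis nf_inv subsetD)
  have c: "fst l \<in> carrier G" "fst m \<in> carrier G" using l(1) m(1) D(2,3) by auto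
  have "fst l \<noteq> fst m"
  proof
    assume "fst l = fst m"
    then have "lval l = lval m \<or> lval l = inv (lval m)"
      using c by (cases "snd l"; cases "snd m") (simp_all add: letter_value_def)
    then show False using xy(2) \<open>x \<noteq> inv y\<close> l(2) m(2) by metis
  qed
  then have "{a, b} = {fst l, fst m}" using l(1) m(1) by auto
  moreover have "inverted_by \<one> (fst l)" "inverted_by \<one> (fst m)"
    using inverted[OF c(1)] inverted[OF c(2)] l(2) m(2) xS yS by simp_all
  ultimately have "inverted_by \<one> a" "inverted_by \<one> b" by (metis insertCI insertE singletonD)+
  then have "coinverted a b" unfolding coinverted_def by blast
  then show False using D(1) by (simp add: bad_pair_def)
qed

section \<open>Primitive elements and the inverting automorphism\<close>

lemma generating_pair_coinverted:
  assumes "a \<in> carrier G" "b \<in> carrier G" "generate G {a, b} = carrier G"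
  shows "coinverted a b"
proof (rule ccontr)
  assume "\<not> coinverted a b"
  then have "(\<lambda>(u, v). bad_pair u v) (a, b)" using assms by (simp add: bad_pair_def)
  from ex_has_least_nat[of "\<lambda>(u, v). bad_pair u v", OF this, of "\<lambda>(u, v). len u + len v"]
  obtain u v where "minimal_bad_pair u v" by (auto simp: minimal_bad_pair_def)
  then show False using no_minimal_bad_pair by blast
qed

lemma primitive_conjugate_theta:
  assumes "p \<in> primitive_elements G"
  obtains c where "c \<in> carrier G" "theta p = c \<otimes> inv p \<otimes> inv c"
proof -
  obtain T where T: "free_basis G T" "p \<in> T"
    using assms by (auto simp: primitive_elements_def)
  \<comment> \<open>With \<open>T\<close> in the role of the basis, \<open>basis_card_le\<close>
    bounds its size by that of the generating set \<open>S\<close>.\<close>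
  interpret T: free_group G T by unfold_locales (rule T(1))
  have "finite S" using rank by (intro card_ge_0_finite) simp
  then have "finite T" "card T \<le> 2"
    using T.basis_card_le[of S] S_closed generate_S rank by auto
  then have "card (T - {p}) \<le> 1" "finite (T - {p})" using T(2) by simp_all
  then have eq: "\<forall>y\<in>T - {p}. \<forall>z\<in>T - {p}. y = z" by (simp add: card_le_Suc0_iff_eq)
  obtain b where b: "T - {p} \<subseteq> {b}" "b \<in> carrier G"
  proof (cases "T - {p} = {}")
    case True
    \<comment> \<open>If \<open>T\<close> is just \<open>{p}\<close>, \<open>\<one>\<close> fills
      the second place of the pair.\<close>
    show ?thesis by (rule that[of \<one>]) (use True in auto)
  next
    case False
    then obtain b where "b \<in> T - {p}" by blast
    then show ?thesis using that[of b] eq T.S_closed by blast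
  qed
  have p: "p \<in> carrier G" using T(2) T.S_closed by auto
  have "generate G {p, b} = carrier G"
    using T.S_closed b p
    by (intro generate_eq_carrierI[OF _ T.generate_S]) (auto intro: generate.incl)
  then show thesis
    using generating_pair_coinverted[of p b] p b that by (auto simp: coinverted_def inverted_by_def)
qed

end

section \<open>A quasimorphism bounded on primitive elements\<close>

definition coord :: "'a \<Rightarrow> 'a \<times> bool \<Rightarrow> int" where
  "coord x l = (if fst l = x then if snd l then 1 else -1 else 0)"

definition turn :: "'a \<Rightarrow> 'a \<Rightarrow> 'a \<times> bool \<Rightarrow> 'a \<times> bool \<Rightarrow> int" where
  "turn x y l m = coord x l * coord y m - coord y l * coord x m"

text \<open>For distinct \<open>x\<close> and \<open>y\<close>, a word in them traces a lattice path
  with \<open>x\<close> pointing east and \<open>y\<close> north; this is its number of left turns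
  minus its number of right turns.\<close>

fun turning :: "'a \<Rightarrow> 'a \<Rightarrow> ('a \<times> bool) list \<Rightarrow> int" where
  "turning x y (l # m # w) = turn x y l m + turning x y (m # w)"
| "turning x y w = 0"

lemma turn_bound: "\<bar>turn x y l m\<bar> \<le> 1"
  by (auto simp: turn_def coord_def)

lemma turn_flip [simp]: "turn x y (flip l) (flip m) = turn x y l m"
  by (auto simp: turn_def coord_def)

lemma turn_swap: "turn x y m l = - turn x y l m"
  by (simp add: turn_def)

lemma turning_append:
  "turning x y (u @ v) = turning x y u + turning x y v +
     (if u = [] \<or> v = [] then 0 else turn x y (last u) (hd v))"
proof (induction u rule: induct_list012)
  case (2 l)
  then show ?case by (cases v) auto
qed auto

lemma turning_append_bound: "\<bar>turning x y (u @ v) - turning x y u - turning x y v\<bar> \<le> 1"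
  using turn_bound[of x y "last u" "hd v"] by (simp add: turning_append)

lemma turning_map_flip: "turning x y (map flip w) = turning x y w"
  by (induction w rule: induct_list012) auto

text \<open>Traversed backwards, a left turn becomes a right turn: flipping both letters leaves
  \<open>turn\<close> unchanged, swapping them negates it.\<close>

lemma turning_inv_word: "turning x y (inv_word w) = - turning x y w"
proof (induction w rule: induct_list012)
  case (3 l m w)
  have "turning x y (inv_word (m # w) @ [flip l]) = turning x y (inv_word (m # w)) + turn x y m l"
    by (subst turning_append) simp
  then show ?case using 3 turn_swap[of x y m l] by simp
qed auto

context free_group
begin

definition qm :: "'a \<Rightarrow> 'a \<Rightarrow> 'a \<Rightarrow> int" where
  "qm x y g = turning x y (nf g)"

text \<open>The contributions of \<open>s\<close> and \<open>inv_word s\<close> cancel, and each of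
  the seams in \<open>p @ s\<close>, \<open>inv_word s @ q\<close> and \<open>p @ q\<close> costs at
  most 1.\<close>

lemma qm_mult:
  assumes "g \<in> carrier G" "h \<in> carrier G"
  shows "\<bar>qm x y (g \<otimes> h) - qm x y g - qm x y h\<bar> \<le> 3"
proof -
  obtain p s q where e: "nf g = p @ s" "nf h = inv_word s @ q" "nf (g \<otimes> h) = p @ q"
    using nf_mult[OF assms] by blast
  show ?thesis
    using turning_append_bound[of x y p s] turning_append_bound[of x y "inv_word s" q]
      turning_append_bound[of x y p q]
    unfolding qm_def e turning_inv_word by linarith
qed

lemma qm_inv: "g \<in> carrier G \<Longrightarrow> qm x y (inv g) = - qm x y g"
  by (simp add: qm_def turning_inv_word)

lemma qm_theta: "g \<in> carrier G \<Longrightarrow> qm x y (theta g) = qm x y g"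
  by (simp add: qm_def nf_theta turning_map_flip)

end

section \<open>Bounds on products of primitive elements and growth on commutator powers\<close>

context free_group_rank2
begin

lemma primitive_closed: "primitive_elements G \<subseteq> carrier G"
  by (auto simp: primitive_elements_def free_basis_def)

text \<open>\<open>theta p\<close> has the value \<open>qm x y p\<close>, but as a conjugate of
  \<open>inv p\<close> its value is within 6 of \<open>- qm x y p\<close>, since the values of
  \<open>c\<close> and \<open>inv c\<close> cancel and two products cost 3 each. Hence twice the
  absolute value is at most 6.\<close>

lemma qm_primitive:
  assumes "p \<in> primitive_elements G"
  shows "\<bar>qm x y p\<bar> \<le> 3"
proof -
  have p: "p \<in> carrier G" using assms primitive_closed by auto
  obtain c where c: "c \<in> carrier G" "theta p = c \<otimes> inv p \<otimes> inv c"
    using primitive_conjugate_theta[OF assms] .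
  have "qm x y (c \<otimes> inv p \<otimes> inv c) = qm x y p" using qm_theta[OF p] c(2) by metis
  then show ?thesis
    using qm_mult[of "c \<otimes> inv p" "inv c" x y] qm_mult[of c "inv p" x y] p c(1)
      qm_inv[of p x y] qm_inv[of c x y] by simp
qed

text \<open>Each further factor adds at most 3 for its own value and 3 for the defect.\<close>

lemma qm_product:
  assumes "set ps \<subseteq> primitive_elements G"
  shows "list_product G ps \<in> carrier G \<and> \<bar>qm x y (list_product G ps)\<bar> \<le> 6 * int (length ps)"
  using assms
proof (induction ps)
  case Nil
  show ?case by (simp add: list_product_def qm_def)
next
  case (Cons p ps)
  have e: "list_product G (p # ps) = p \<otimes> list_product G ps" by (simp add: list_product_def)
  have "p \<in> carrier G" "\<bar>qm x y p\<bar> \<le> 3"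
    using Cons.prems primitive_closed qm_primitive by auto
  then show ?case
    using Cons qm_mult[of p "list_product G ps" x y] unfolding e by auto
qed

lemma qm_unbounded:
  obtains x y g where "g \<in> carrier G" "int n \<le> qm x y g"
proof -
  obtain x y where xy: "S = {x, y}" "x \<noteq> y" using rank by (auto simp: card_2_iff)
  \<comment> \<open>The commutator traces a unit square counterclockwise: three left turns within
    one copy and a fourth at the seam between two copies.\<close>
  define c where "c = [(x, True), (y, True), (x, False), (y, False)]"
  define w where "w n = concat (replicate n c)" for n
  have w: "w 0 = []" "w (Suc n) = c @ w n" for n
    by (simp_all add: w_def)
  have hd: "hd (w n) = (x, True)" if "w n \<noteq> []" for n
    using that by (cases n) (auto simp: w_def c_def)
  have ne: "x \<noteq> y" "y \<noteq> x" and S: "x \<in> S" "y \<in> S" using xy by auto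
  have c: "normal_word c" "turning x y c = 3" "last c = (y, False)"
    using S ne by (simp_all add: normal_word_def c_def reduced_word_Cons flip_def turn_def coord_def)
  have seam: "turn x y (y, False) (x, True) = 1" "(x, True) \<noteq> flip (y, False)"
    using ne by (simp_all add: turn_def coord_def flip_def)
  have "normal_word (w n) \<and> int n \<le> turning x y (w n)" for n
  proof (induction n)
    case 0
    show ?case by (simp add: w(1) normal_word_def)
  next
    case (Suc n)
    have "normal_word (c @ w n)"
      using Suc c(1) hd[of n] seam(2) unfolding normal_word_def reduced_word_append c(3)
      by (auto simp: image_Un)
    \<comment> \<open>The seam adds 1 if \<open>w n\<close> is nonempty and nothing otherwise, hence
      only an inequality.\<close>
    moreover have "turning x y (c @ w n) \<ge> 3 + turning x y (w n)"
      using hd[of n] seam(1) unfolding turning_append c(2,3) by auto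
    ultimately show ?case using Suc unfolding w(2) by simp
  qed
  then have "normal_word (w n)" "int n \<le> turning x y (w n)" by auto
  then show thesis
    using that[of "wval (w n)" x y] letters_closed by (simp add: qm_def)
qed

lemma not_product_of_primitives:
  "\<exists>g\<in>carrier G. \<forall>j\<le>k. g \<notin> products_of G (primitive_elements G) j"
proof -
  \<comment> \<open>The bound is one more than what \<open>k\<close> primitive factors can
    reach.\<close>
  obtain x y g where g: "g \<in> carrier G" "int (6 * k + 1) \<le> qm x y g"
    using qm_unbounded .
  have "g \<notin> products_of G (primitive_elements G) j" if "j \<le> k" for j
  proof
    assume "g \<in> products_of G (primitive_elements G) j"
    then obtain ps where "g = list_product G ps" "set ps \<subseteq> primitive_elements G" "length ps = j"
      by (auto simp: products_of_def)
    then show False using qm_product[of ps x y] g(2) that by auto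
  qed
  then show ?thesis using g(1) by blast
qed

end

theorem corollary1p7:
  fixes F :: "('a, 'b) monoid_scheme"
  assumes "free_group_of_rank F 2"
  shows "primitive_width F = \<infinity> \<and>
    (\<forall>k::nat. \<exists>g\<in>carrier F. \<forall>j\<le>k. g \<notin> products_of F (primitive_elements F) j)"
proof -
  obtain S where S: "group F" "free_basis F S" "card S = 2"
    using assms by (auto simp: free_group_of_rank_def)
  interpret free_group_rank2 F S
    using S by (simp add: free_group_rank2_def free_group_def free_group_axioms_def
        free_group_rank2_axioms_def)
  have "enat k \<le> primitive_width F" for k
  proof -
    obtain g where g: "g \<in> carrier F" "\<And>j. j \<le> k \<Longrightarrow> g \<notin> products_of F (primitive_elements F) j"
      using not_product_of_primitives by blast
    \<comment> \<open>Every exponent in the set whose infimum defines \<open>length_wrt\<close>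
      exceeds \<open>k\<close>.\<close>
    then have "enat k \<le> length_wrt F (primitive_elements F) g"
      unfolding length_wrt_def by (intro Inf_greatest) (auto intro: ccontr)
    also have "\<dots> \<le> primitive_width F"
      unfolding primitive_width_def width_def using g(1) by (rule SUP_upper)
    finally show ?thesis .
  qed
  then have "primitive_width F = \<infinity>"
    by (metis enat_ord_simps(1) Suc_n_not_le_n enat.exhaust)
  then show ?thesis using not_product_of_primitives by blast
qed

end
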